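(* Let $\{\Omega_p\}_{p\in\mathcal{P}}$ be a finite family of pairwise disjoint patches in $\mathcal{G}$, with $\Omega_{\mathrm{off}}=\mathcal{G}\setminus\bigcup_p\Omega_p$. Suppose: (i) (stencil compatibility) for every $\alpha\in\mathcal{I}$, the support $\mathrm{supp}(\ell_\alpha)$ is either contained in $\Omega_p$ for some $p\in\mathcal{P}$ or contained in $\Omega_{\mathrm{off}}$; (ii) each patch $\Omega_p$ is feasible, i.e. $\mathcal{C}_u(\Omega_p)\ne\emptyset$, and admits a patch-level solution $(u_{I,p}^\star,\pi_p^\star)\in\arg\min\{J_{\Omega_p}(u_I,\pi):u_I\in\mathcal{C}_u(\Omega_p),\ \pi\in\mathcal{C}_\pi(\Omega_p)\}$; (iii) the baseline $u^0$ belongs to $\mathcal{C}_{\mathrm{glob}}$. Define the global post-fit surface $u^\star\in\mathbb{R}^G$ by $u^\star_{i,j}=(u_{I,p}^\star)_{i,j}$ if $(i,j)\in\Omega_p$ for some $p$, and $u^\star_{i,j}=u^0_{i,j}$ if $(i,j)\in\Omega_{\mathrm{off}}$. Then: (a) $u^\star\in\mathcal{C}_{\mathrm{glob}}$, i.e. $u^\star$ is statically no-arbitrage on $\mathcal{G}$; and (b) $u^\star_{i,j}=u^0_{i,j}$ for all $(i,j)\in\Omega_{\mathrm{off}}$.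
   Context: Grid. $\mathcal{G}=\{1,\dots,n_m\}\times\{1,\dots,n_\tau\}$, $G=n_mn_\tau$, identified with $\{1,\dots,G\}$; nodal surfaces are $u\in\mathbb{R}^G$; $u^0\in\mathbb{R}^G$ is a fixed baseline; $F_{i,j}\in\mathbb{R}$ are fixed forwards; $A_{\tau|K}\in\mathbb{R}^{G\times G}$ is a fixed calendar matrix. Global no-arbitrage. The finite family of linear inequalities $\ell_\alpha^\top u\le r_\alpha$, $\alpha\in\mathcal{I}$, consists of: $-u_{i,j}\le0$ and $u_{i,j}\le F_{i,j}$ for each node; $u_{i+1,j}-u_{i,j}\le0$ for $1\le i\le n_m-1$ and each $j$; $-u_{i+1,j}+2u_{i,j}-u_{i-1,j}\le0$ for $2\le i\le n_m-1$ and each $j$; $-(A_{\tau|K}u)_g\le0$ for each $g$. $\mathrm{supp}(\ell_\alpha)$ is the set of nodes where $\ell_\alpha\in\mathbb{R}^G$ has a nonzero entry, and $\mathcal{C}_{\mathrm{glob}}=\{u\in\mathbb{R}^G:\ell_\alpha^\top u\le r_\alpha\ \forall\alpha\in\mathcal{I}\}$. Patches. A patch is a nonempty $\Omega\subset\mathcal{G}$, $N_\Omega=|\Omega|$. For $u_I\in\mathbb{R}^{N_\Omega}$ (indexed by $\Omega$) the assembled surface $u(u_I)=P_\Omega u_I+u^{0,\mathrm{off}}\in\mathbb{R}^G$ equals $u_I$ on $\Omega$ and $u^0$ off $\Omega$ ($P_\Omega$ the injection). $\mathcal{C}_u(\Omega)=\{u_I\in\mathbb{R}^{N_\Omega}:u(u_I)\in\mathcal{C}_{\mathrm{glob}}\}$.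 With fixed price levels $u_1<\dots<u_{n_u}$, $\mathcal{L}_\Omega=\{(i,j,k):(i,j)\in\Omega,1\le k\le n_u\}$, and $\mathcal{C}_\pi(\Omega)$ is the set of $\pi\in\mathbb{R}^{N_\Omega n_u}$ with $\pi_{i,j,k}\ge0$ and total sum $1$. Patch energy. $$J_\Omega(u_I,\pi)=\sum_{q\in Q_\Omega}\Big(\frac{d_q(u(u_I))^2}{\varepsilon+M_q(\pi)}+\lambda_{\mathrm{noise}}(\varepsilon+M_q(\pi))\Big)+\frac{\lambda_{\mathrm{cl}}}{2}\|u_I-u_I^0\|_2^2+\frac{\lambda_{\mathrm{surf}}}{2}\rho_\Omega(u_I)^\top H_\rho\rho_\Omega(u_I)+\frac{\lambda_\pi}{2}\pi^\top H_\pi\pi,$$ where $\varepsilon,\lambda_{\mathrm{cl}}>0$, $\lambda_{\mathrm{noise}},\lambda_{\mathrm{surf}},\lambda_\pi\ge0$; $u_I^0=u^0|_\Omega$; quote $q$ has band $[b_q,a_q]$, $0\le b_q\le a_q$, and $d_q(u)=\max\{b_q-(Su)_q,0,(Su)_q-a_q\}$ for a fixed interpolation matrix $S\in\mathbb{R}^{Q\times G}$; $Q_\Omega$ is the set of quotes whose row of $S$ has a nonzero entry in $\Omega$, each with a fixed representative node $(i_q,j_q)\in\Omega$; $M_q(\pi)=\sum_{k:\,u_k<b_q\text{ or }u_k>a_q}\pi_{i_q,j_q,k}$; $\rho_\Omega(u_I)=R_\Omega D_\rho u(u_I)$ with $D_\rho\in\mathbb{R}^{N_\rho\times G}$ fixed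 and $R_\Omega$ extracting the rows $r$ with $(D_\rho P_\Omega)_{r,\cdot}\neq0$; $H_\rho$ is symmetric positive semidefinite; $H_\pi$ is a fixed symmetric positive semidefinite matrix (a weighted graph Laplacian on the nearest-neighbour graph of $\mathcal{L}_\Omega$ plus a nonnegative diagonal potential). A patch-level solution is any minimiser of $J_\Omega$ over $\mathcal{C}_u(\Omega)\times\mathcal{C}_\pi(\Omega)$. *)

theory Defs
  imports "HOL-Analysis.L2_Norm" "HOL-Library.Disjoint_Sets" "HOL-Library.FuncSet"
begin

type_synonym node = "nat \<times> nat"
type_synonym cell = "node \<times> nat"

text \<open>
  A real vector indexed by a finite set \<open>A\<close> is an extensional function, so that two vectors
  are equal iff they agree on \<open>A\<close>. Matrices are plain functions that are only evaluated on
  their index sets.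
\<close>

abbreviation vec :: "'a set \<Rightarrow> ('a \<Rightarrow> real) set" where
  "vec A \<equiv> A \<rightarrow>\<^sub>E UNIV"

definition qform :: "'a set \<Rightarrow> ('a \<Rightarrow> 'a \<Rightarrow> real) \<Rightarrow> ('a \<Rightarrow> real) \<Rightarrow> real" where
  "qform A H x = (\<Sum>i\<in>A. \<Sum>j\<in>A. x i * H i j * x j)"

definition sym_psd :: "'a set \<Rightarrow> ('a \<Rightarrow> 'a \<Rightarrow> real) \<Rightarrow> bool" where
  "sym_psd A H \<longleftrightarrow> (\<forall>i\<in>A. \<forall>j\<in>A. H i j = H j i) \<and> (\<forall>x\<in>vec A. 0 \<le> qform A H x)"

text \<open>
  The fixed data. Matrices and vectors over the grid are indexed by nodes rather than by
  \<open>{1..G}\<close>. The representative node of a quote and the matrices \<open>H_rho\<close>, \<open>H_pi\<close> take the patch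
  as an argument, because their range and dimensions depend on it.
\<close>

record fit_model =
  n_m :: nat
  n_tau :: nat
  base :: "node \<Rightarrow> real"
  fwd :: "node \<Rightarrow> real"
  cal :: "node \<Rightarrow> node \<Rightarrow> real"
  n_u :: nat
  price :: "nat \<Rightarrow> real"
  n_quotes :: nat
  bid :: "nat \<Rightarrow> real"
  ask :: "nat \<Rightarrow> real"
  interp :: "nat \<Rightarrow> node \<Rightarrow> real"
  rep_node :: "node set \<Rightarrow> nat \<Rightarrow> node"
  n_rho :: nat
  D_rho :: "nat \<Rightarrow> node \<Rightarrow> real"
  H_rho :: "node set \<Rightarrow> nat \<Rightarrow> nat \<Rightarrow> real"
  H_pi :: "node set \<Rightarrow> cell \<Rightarrow> cell \<Rightarrow> real"
  eps :: real
  lam_noise :: real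
  lam_cl :: real
  lam_surf :: real
  lam_pi :: real

definition grid :: "fit_model \<Rightarrow> node set" where
  "grid M = {1..n_m M} \<times> {1..n_tau M}"

definition unit_vec :: "node \<Rightarrow> node \<Rightarrow> real" where
  "unit_vec g h = (if h = g then 1 else 0)"

datatype constr =
    Nonneg node
  | Upper node
  | Mono nat nat
  | Convex nat nat
  | Calendar node

definition constr_index :: "fit_model \<Rightarrow> constr set" where
  "constr_index M =
     Nonneg ` grid M \<union> Upper ` grid M
     \<union> {Mono i j |i j. i \<in> {1..<n_m M} \<and> j \<in> {1..n_tau M}}
     \<union> {Convex i j |i j. i \<in> {2..<n_m M} \<and> j \<in> {1..n_tau M}}
     \<union> Calendar ` grid M"

fun ell :: "fit_model \<Rightarrow> constr \<Rightarrow> node \<Rightarrow> real" where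
  "ell M (Nonneg g) h = - unit_vec g h"
| "ell M (Upper g) h = unit_vec g h"
| "ell M (Mono i j) h = unit_vec (i + 1, j) h - unit_vec (i, j) h"
| "ell M (Convex i j) h =
     - unit_vec (i + 1, j) h + 2 * unit_vec (i, j) h - unit_vec (i - 1, j) h"
| "ell M (Calendar g) h = - cal M g h"

fun rhs :: "fit_model \<Rightarrow> constr \<Rightarrow> real" where
  "rhs M (Nonneg g) = 0"
| "rhs M (Upper g) = fwd M g"
| "rhs M (Mono i j) = 0"
| "rhs M (Convex i j) = 0"
| "rhs M (Calendar g) = 0"

definition supp :: "fit_model \<Rightarrow> constr \<Rightarrow> node set" where
  "supp M \<alpha> = {g \<in> grid M. ell M \<alpha> g \<noteq> 0}"

definition C_glob :: "fit_model \<Rightarrow> (node \<Rightarrow> real) set" where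
  "C_glob M = {u \<in> vec (grid M). \<forall>\<alpha>\<in>constr_index M. (\<Sum>g\<in>grid M. ell M \<alpha> g * u g) \<le> rhs M \<alpha>}"

definition is_patch :: "fit_model \<Rightarrow> node set \<Rightarrow> bool" where
  "is_patch M \<Omega> \<longleftrightarrow> \<Omega> \<noteq> {} \<and> \<Omega> \<subseteq> grid M"

definition assemble :: "fit_model \<Rightarrow> node set \<Rightarrow> (node \<Rightarrow> real) \<Rightarrow> node \<Rightarrow> real" where
  "assemble M \<Omega> uI = (\<lambda>g\<in>grid M. if g \<in> \<Omega> then uI g else base M g)"

definition C_u :: "fit_model \<Rightarrow> node set \<Rightarrow> (node \<Rightarrow> real) set" where
  "C_u M \<Omega> = {uI \<in> vec \<Omega>. assemble M \<Omega> uI \<in> C_glob M}"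

definition cells :: "fit_model \<Rightarrow> node set \<Rightarrow> cell set" where
  "cells M \<Omega> = \<Omega> \<times> {1..n_u M}"

definition C_pi :: "fit_model \<Rightarrow> node set \<Rightarrow> (cell \<Rightarrow> real) set" where
  "C_pi M \<Omega> = {\<pi> \<in> vec (cells M \<Omega>). (\<forall>c\<in>cells M \<Omega>. 0 \<le> \<pi> c) \<and> (\<Sum>c\<in>cells M \<Omega>. \<pi> c) = 1}"

definition quote_val :: "fit_model \<Rightarrow> nat \<Rightarrow> (node \<Rightarrow> real) \<Rightarrow> real" where
  "quote_val M q u = (\<Sum>g\<in>grid M. interp M q g * u g)"

definition band_dist :: "fit_model \<Rightarrow> nat \<Rightarrow> (node \<Rightarrow> real) \<Rightarrow> real" where
  "band_dist M q u = Max {bid M q - quote_val M q u, 0, quote_val M q u - ask M q}"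

definition patch_quotes :: "fit_model \<Rightarrow> node set \<Rightarrow> nat set" where
  "patch_quotes M \<Omega> = {q \<in> {1..n_quotes M}. \<exists>g\<in>\<Omega>. interp M q g \<noteq> 0}"

definition out_mass :: "fit_model \<Rightarrow> node set \<Rightarrow> nat \<Rightarrow> (cell \<Rightarrow> real) \<Rightarrow> real" where
  "out_mass M \<Omega> q \<pi> =
     (\<Sum>k | k \<in> {1..n_u M} \<and> (price M k < bid M q \<or> price M k > ask M q). \<pi> (rep_node M \<Omega> q, k))"

text \<open>
  The column of \<open>D_rho P_\<Omega>\<close> at \<open>g \<in> \<Omega>\<close> is the column of \<open>D_rho\<close> at \<open>g\<close>, so a row of
  \<open>D_rho P_\<Omega>\<close> is nonzero iff the row of \<open>D_rho\<close> has a nonzero entry in \<open>\<Omega>\<close>.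
\<close>

definition rho_rows :: "fit_model \<Rightarrow> node set \<Rightarrow> nat set" where
  "rho_rows M \<Omega> = {r \<in> {1..n_rho M}. \<exists>g\<in>\<Omega>. D_rho M r g \<noteq> 0}"

definition rho :: "fit_model \<Rightarrow> node set \<Rightarrow> (node \<Rightarrow> real) \<Rightarrow> nat \<Rightarrow> real" where
  "rho M \<Omega> uI = (\<lambda>r\<in>rho_rows M \<Omega>. \<Sum>g\<in>grid M. D_rho M r g * assemble M \<Omega> uI g)"

definition energy :: "fit_model \<Rightarrow> node set \<Rightarrow> (node \<Rightarrow> real) \<Rightarrow> (cell \<Rightarrow> real) \<Rightarrow> real" where
  "energy M \<Omega> uI \<pi> =
     (\<Sum>q\<in>patch_quotes M \<Omega>.
        (band_dist M q (assemble M \<Omega> uI))\<^sup>2 / (eps M + out_mass M \<Omega> q \<pi>)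
        + lam_noise M * (eps M + out_mass M \<Omega> q \<pi>))
     + lam_cl M / 2 * (L2_set (\<lambda>g. uI g - base M g) \<Omega>)\<^sup>2
     + lam_surf M / 2 * qform (rho_rows M \<Omega>) (H_rho M \<Omega>) (rho M \<Omega> uI)
     + lam_pi M / 2 * qform (cells M \<Omega>) (H_pi M \<Omega>) \<pi>"

definition patch_solution ::
    "fit_model \<Rightarrow> node set \<Rightarrow> (node \<Rightarrow> real) \<Rightarrow> (cell \<Rightarrow> real) \<Rightarrow> bool" where
  "patch_solution M \<Omega> uI \<pi> \<longleftrightarrow>
     is_arg_min (\<lambda>(v, \<sigma>). energy M \<Omega> v \<sigma>) (\<lambda>x. x \<in> C_u M \<Omega> \<times> C_pi M \<Omega>) (uI, \<pi>)"

text \<open>Nearest neighbours in the three-dimensional lattice: \<open>\<ell>\<^sup>1\<close>-distance one.\<close>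

fun adjacent :: "cell \<Rightarrow> cell \<Rightarrow> bool" where
  "adjacent ((i, j), k) ((i', j'), k') \<longleftrightarrow>
     \<bar>int i - int i'\<bar> + \<bar>int j - int j'\<bar> + \<bar>int k - int k'\<bar> = 1"

definition laplacian :: "cell set \<Rightarrow> (cell \<Rightarrow> cell \<Rightarrow> real) \<Rightarrow> cell \<Rightarrow> cell \<Rightarrow> real" where
  "laplacian L w x y =
     (if x = y then \<Sum>z | z \<in> L \<and> adjacent x z. w x z
      else if adjacent x y then - w x y else 0)"

definition laplacian_plus_potential :: "cell set \<Rightarrow> (cell \<Rightarrow> cell \<Rightarrow> real) \<Rightarrow> bool" where
  "laplacian_plus_potential L H \<longleftrightarrow>
     (\<exists>w v. (\<forall>x\<in>L. \<forall>y\<in>L. 0 \<le> w x y \<and> w x y = w y x) \<and> (\<forall>x\<in>L. 0 \<le> v x) \<and>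
        (\<forall>x\<in>L. \<forall>y\<in>L. H x y = laplacian L w x y + (if x = y then v x else 0)))"

definition valid_model :: "fit_model \<Rightarrow> bool" where
  "valid_model M \<longleftrightarrow>
     base M \<in> vec (grid M) \<and>
     strict_mono_on {1..n_u M} (price M) \<and>
     (\<forall>q\<in>{1..n_quotes M}. 0 \<le> bid M q \<and> bid M q \<le> ask M q) \<and>
     0 < eps M \<and> 0 < lam_cl M \<and> 0 \<le> lam_noise M \<and> 0 \<le> lam_surf M \<and> 0 \<le> lam_pi M \<and>
     (\<forall>\<Omega>. is_patch M \<Omega> \<longrightarrow>
        (\<forall>q\<in>patch_quotes M \<Omega>. rep_node M \<Omega> q \<in> \<Omega>) \<and>
        sym_psd (rho_rows M \<Omega>) (H_rho M \<Omega>) \<and>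
        sym_psd (cells M \<Omega>) (H_pi M \<Omega>) \<and>
        laplacian_plus_potential (cells M \<Omega>) (H_pi M \<Omega>))"

definition off_patch :: "fit_model \<Rightarrow> 'p set \<Rightarrow> ('p \<Rightarrow> node set) \<Rightarrow> node set" where
  "off_patch M P \<Omega> = grid M - (\<Union>p\<in>P. \<Omega> p)"

text \<open>The description operator is well defined when the patches are pairwise disjoint.\<close>

definition postfit ::
    "fit_model \<Rightarrow> 'p set \<Rightarrow> ('p \<Rightarrow> node set) \<Rightarrow> ('p \<Rightarrow> node \<Rightarrow> real) \<Rightarrow> node \<Rightarrow> real" where
  "postfit M P \<Omega> uI =
     (\<lambda>g\<in>grid M. if \<exists>p\<in>P. g \<in> \<Omega> p then uI (THE p. p \<in> P \<and> g \<in> \<Omega> p) g else base M g)"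

end

theory Submission imports Defs begin

text \<open>
  A constraint only sees the surface on its support. There the post-fit surface coincides with
  a surface already known to be globally feasible: the assembled surface of the patch containing
  the support, or the baseline.
\<close>

lemma ell_sum_cong:
  assumes "\<And>g. g \<in> supp M \<alpha> \<Longrightarrow> u g = v g"
  shows "(\<Sum>g\<in>grid M. ell M \<alpha> g * u g) = (\<Sum>g\<in>grid M. ell M \<alpha> g * v g)"
  \<comment> \<open>At a grid node outside the support the coefficient is zero, so both summands
    vanish whatever the values of \<open>u\<close> and \<open>v\<close>.\<close>
  using assms by (intro sum.cong) (auto simp: supp_def)

lemma C_glob_le:
  assumes "u \<in> C_glob M" "\<alpha> \<in> constr_index M"
  shows "(\<Sum>g\<in>grid M. ell M \<alpha> g * u g) \<le> rhs M \<alpha>"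
  using assms by (simp add: C_glob_def)

lemma postfit_in_vec: "postfit M P \<Omega> uI \<in> vec (grid M)"
  by (simp add: postfit_def)

text \<open>Disjointness leaves \<open>p\<close> as the only index whose patch contains
  \<open>g\<close>, so the description operator picks it. The value is expressed through
  \<open>assemble\<close> because that is the surface \<open>C_u\<close> constrains; at nodes
  outside the grid both sides are \<open>undefined\<close>.\<close>

lemma postfit_on_patch:
  assumes "disjoint_family_on \<Omega> P" "p \<in> P" "g \<in> \<Omega> p"
  shows "postfit M P \<Omega> uI g = assemble M (\<Omega> p) (uI p) g"
proof -
  have "(THE p. p \<in> P \<and> g \<in> \<Omega> p) = p"
    using assms by (intro the_equality) (auto simp: disjoint_family_on_def)
  then show ?thesis
    using assms(2,3) by (auto simp: postfit_def assemble_def)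
qed

lemma postfit_off_patch:
  assumes "g \<in> off_patch M P \<Omega>"
  shows "postfit M P \<Omega> uI g = base M g"
  using assms by (auto simp: postfit_def off_patch_def)

text \<open>A minimiser belongs to the set minimised over, and membership in \<open>C_u\<close> is
  by definition global feasibility of the assembled surface.\<close>

lemma patch_solution_assemble_in_C_glob:
  assumes "patch_solution M \<Omega> uI \<pi>"
  shows "assemble M \<Omega> uI \<in> C_glob M"
  using assms by (auto simp: patch_solution_def is_arg_min_def C_u_def)

theorem proposition22:
  fixes M :: fit_model
    and P :: "'p set"
    and \<Omega> :: "'p \<Rightarrow> node set"
    and uI :: "'p \<Rightarrow> node \<Rightarrow> real"
    and \<pi> :: "'p \<Rightarrow> cell \<Rightarrow> real"
  assumes model: "valid_model M"
    and finite_family: "finite P"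
    and patches: "\<And>p. p \<in> P \<Longrightarrow> is_patch M (\<Omega> p)"
    and disjoint: "disjoint_family_on \<Omega> P"
    and stencil: "\<And>\<alpha>. \<alpha> \<in> constr_index M \<Longrightarrow>
          (\<exists>p\<in>P. supp M \<alpha> \<subseteq> \<Omega> p) \<or> supp M \<alpha> \<subseteq> off_patch M P \<Omega>"
    and feasible: "\<And>p. p \<in> P \<Longrightarrow> C_u M (\<Omega> p) \<noteq> {}"
    and solution: "\<And>p. p \<in> P \<Longrightarrow> patch_solution M (\<Omega> p) (uI p) (\<pi> p)"
    and baseline: "base M \<in> C_glob M"
  shows "postfit M P \<Omega> uI \<in> C_glob M
       \<and> (\<forall>g\<in>off_patch M P \<Omega>. postfit M P \<Omega> uI g = base M g)"
proof
  let ?u = "postfit M P \<Omega> uI"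
  have "(\<Sum>g\<in>grid M. ell M \<alpha> g * ?u g) \<le> rhs M \<alpha>" if \<alpha>: "\<alpha> \<in> constr_index M" for \<alpha>
  proof -
    \<comment> \<open>The comparison surface \<open>v\<close> may change with \<alpha>: the
      inequalities are checked one at a time, so no single \<open>v\<close> has to match the
      post-fit surface everywhere.\<close>
    obtain v where v: "v \<in> C_glob M" and eq: "\<And>g. g \<in> supp M \<alpha> \<Longrightarrow> ?u g = v g"
      using stencil[OF \<alpha>]
    proof (elim disjE bexE)
      fix p
      assume p: "p \<in> P" and sub: "supp M \<alpha> \<subseteq> \<Omega> p"
      show thesis
      proof (rule that)
        \<comment> \<open>This surface has baseline values on the other patches, where it may differ
          from \<open>?u\<close>; the support of \<alpha> does not reach them.\<close>
        show "assemble M (\<Omega> p) (uI p) \<in> C_glob M"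
          using solution[OF p] by (rule patch_solution_assemble_in_C_glob)
        show "?u g = assemble M (\<Omega> p) (uI p) g" if "g \<in> supp M \<alpha>" for g
          using postfit_on_patch[OF disjoint p] sub that by blast
      qed
    next
      assume "supp M \<alpha> \<subseteq> off_patch M P \<Omega>"
      \<comment> \<open>Here the support meets no patch, and \<open>v\<close> is the baseline
        itself.\<close>
      then show thesis
        using that[OF baseline] postfit_off_patch by blast
    qed
    show ?thesis
      using C_glob_le[OF v \<alpha>] ell_sum_cong[OF eq] by simp
  qed
  then show "?u \<in> C_glob M"
    using postfit_in_vec by (simp add: C_glob_def)
  show "\<forall>g\<in>off_patch M P \<Omega>. ?u g = base M g"
    using postfit_off_patch by blast
qed

end
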